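(* Let $\boldsymbol{s}=(s_1,\ldots,s_n)\in\mathbb{Z}_{\geq 1}^n$ be such that $\gcd(s_{i-1},s_i)=1$ for some $1<i\leq n$, and set $s_0=s_{n+1}=1$. Then the $\boldsymbol{s}$-lecture hall polytope $\mathbf{P}_n^{(\boldsymbol{s})}$ is Gorenstein if and only if for all $2\le j\le n$ both numbers $$\frac{\gcd(s_{j-1},s_j)}{s_{j-1}}+s_j\sum_{k=1}^{j-1}\frac{\gcd(s_{k-1},s_k)}{s_{k-1}s_k}$$ and $$\frac{\gcd(s_{n-j+2},s_{n-j+1})}{s_{n-j+2}}+s_{n-j+1}\sum_{k=1}^{j-1}\frac{\gcd(s_{n-k+2},s_{n-k+1})}{s_{n-k+2}s_{n-k+1}}$$ are integers.
   Context: For $\boldsymbol{s}=(s_1,\ldots,s_n)\in\mathbb{Z}_{\ge1}^n$, the $\boldsymbol{s}$-lecture hall polytope is $$\mathbf{P}_n^{(\boldsymbol{s})}=\left\{\boldsymbol{\lambda}\in\mathbb{R}^n : 0\leq\frac{\lambda_1}{s_1}\leq\frac{\lambda_2}{s_2}\leq\cdots\leq\frac{\lambda_n}{s_n}\leq 1\right\}.$$ It is a lattice simplex. For a lattice polytope $P\subset\mathbb{R}^n$ with vertex set $V(P)$, $\mathrm{cone}(P)=\mathrm{span}_{\mathbb{R}_{\ge0}}\{(\boldsymbol{v},1):\boldsymbol{v}\in V(P)\}\subset\mathbb{R}^{n+1}$, and $\mathrm{cone}(P)^\circ$ denotes its relative interior. $P$ is Gorenstein if its semigroup algebra $k[\mathrm{cone}(P)\cap\mathbb{Z}^{n+1}]$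 is Gorenstein ($k$ an algebraically closed field of characteristic zero); equivalently, there exists $\boldsymbol{g}\in\mathbb{Z}^{n+1}$ with $\boldsymbol{g}+(\mathrm{cone}(P)\cap\mathbb{Z}^{n+1})=\mathrm{cone}(P)^\circ\cap\mathbb{Z}^{n+1}$. *)

theory Defs
  imports "HOL-Analysis.Analysis"
begin

(* The coordinates of real^'n carry no order, so the order lambda_1, ..., lambda_n is given by a
   labelling e, a bijection from {1..CARD('n)} onto the index type: lambda_i is x $ e i.  Only the
   values s 1, ..., s n matter; for these to describe the intended polytope they must be positive. *)
definition lecture_hall_polytope ::
    "(nat \<Rightarrow> 'n::finite) \<Rightarrow> (nat \<Rightarrow> nat) \<Rightarrow> (real ^ 'n) set" where
  "lecture_hall_polytope e s =
     {x. 0 \<le> x $ e 1 / real (s 1) \<and>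
         (\<forall>i\<in>{1..<CARD('n)}. x $ e i / real (s i) \<le> x $ e (Suc i) / real (s (Suc i))) \<and>
         x $ e (CARD('n)) / real (s (CARD('n))) \<le> 1}"

(* R^{n+1} is modelled as (real ^ 'n) \<times> real, the last coordinate being the real component;
   convex_cone hull is the set of all nonnegative linear combinations. *)
definition cone_over :: "(real ^ 'n::finite) set \<Rightarrow> ((real ^ 'n) \<times> real) set" where
  "cone_over P = convex_cone hull {(v, 1) | v. v extreme_point_of P}"

definition integer_points :: "((real ^ 'n::finite) \<times> real) set" where
  "integer_points = {(x, h). (\<forall>i. x $ i \<in> \<int>) \<and> h \<in> \<int>}"

(* The Gorenstein property of a lattice polytope P, in semigroup form: the interior lattice points of
   its cone are a translate of all its lattice points.  This is equivalent to Gorensteinness of the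
   semigroup algebra k[cone_over P \<inter> integer_points]. *)
definition gorenstein_polytope :: "(real ^ 'n::finite) set \<Rightarrow> bool" where
  "gorenstein_polytope P \<longleftrightarrow>
     (\<exists>g\<in>integer_points.
        (\<lambda>u. g + u) ` (cone_over P \<inter> integer_points) =
        rel_interior (cone_over P) \<inter> integer_points)"

end

theory Submission
  imports Defs
begin

text \<open>
  Put \<open>x\<^sub>0 = 0\<close>, let \<open>x\<^sub>n\<^sub>+\<^sub>1\<close> be the height, and let
  \<open>f\<^sub>k = (s\<^sub>k x\<^sub>k\<^sub>+\<^sub>1 - s\<^sub>k\<^sub>+\<^sub>1 x\<^sub>k) / gcd(s\<^sub>k, s\<^sub>k\<^sub>+\<^sub>1)\<close> for \<open>0 \<le> k \<le> n\<close>.  These are the primitive integral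
  facet functionals of the cone, so the polytope is Gorenstein iff some lattice point \<open>g\<close> satisfies
  \<open>f\<^sub>k(g) = 1\<close> for all \<open>k\<close>.  Over the reals this system has exactly one solution,
  \<open>g\<^sub>k = s\<^sub>k S\<^sub>k\<close> with \<open>S\<^sub>k\<close> the \<open>k\<close>-th partial sum of \<open>gcd(s\<^sub>m\<^sub>-\<^sub>1, s\<^sub>m) / (s\<^sub>m\<^sub>-\<^sub>1 s\<^sub>m)\<close>.  The first family
  of numbers in the theorem is \<open>g\<^sub>j\<close>, the second is \<open>s\<^sub>i S\<^sub>n\<^sub>+\<^sub>1 - g\<^sub>i\<close> with \<open>i = n - j + 1\<close>.
  If both are integral, so is every \<open>s\<^sub>i S\<^sub>n\<^sub>+\<^sub>1\<close>, and two coprime neighbours \<open>s\<^sub>i\<^sub>-\<^sub>1\<close>, \<open>s\<^sub>i\<close> force the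
  height \<open>S\<^sub>n\<^sub>+\<^sub>1\<close> of \<open>g\<close> to be an integer as well.
\<close>

section \<open>General facts on halfspaces, integrality and cones\<close>

text \<open>Each \<open>f k\<close> is the inner product with the nonzero vector
  \<open>adjoint (f k) 1\<close>, so its halfspace has the expected interior; interiors commute with
  finite intersections.\<close>

lemma interior_linear_nonneg:
  fixes f :: "'i \<Rightarrow> 'a::euclidean_space \<Rightarrow> real"
  assumes "finite K" and lin: "\<And>k. k \<in> K \<Longrightarrow> linear (f k)"
    and nz: "\<And>k. k \<in> K \<Longrightarrow> \<exists>u. f k u \<noteq> 0"
  shows "interior {u. \<forall>k\<in>K. 0 \<le> f k u} = {u. \<forall>k\<in>K. 0 < f k u}"
proof -
  have half: "interior {u. 0 \<le> f k u} = {u. 0 < f k u}" if k: "k \<in> K" for k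
  proof -
    define a where "a = adjoint (f k) 1"
    have a: "f k u = a \<bullet> u" for u
      using adjoint_works[OF lin[OF k], of u 1] by (simp add: a_def inner_commute)
    with nz[OF k] have "a \<noteq> 0" by auto
    then show ?thesis
      using interior_halfspace_ge[of a 0] by (simp add: a)
  qed
  have "interior (\<Inter>k\<in>K. {u. 0 \<le> f k u}) = (\<Inter>k\<in>K. interior {u. 0 \<le> f k u})"
    using \<open>finite K\<close> by (induction K) auto
  moreover have "(\<Inter>k\<in>K. {u. 0 \<le> f k u}) = {u. \<forall>k\<in>K. 0 \<le> f k u}" by auto
  ultimately show ?thesis using half by auto
qed

lemma Ints_of_coprime_multiples:
  fixes r :: real
  assumes "coprime a b" "real a * r \<in> \<int>" "real b * r \<in> \<int>"
  shows "r \<in> \<int>"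
proof -
  obtain x y where "x * int a + y * int b = 1"
    using bezout_int[of "int a" "int b"] assms(1) by auto
  then have "of_int (x * int a + y * int b) * r = (of_int 1 :: real) * r" by presburger
  then have "r = of_int x * (real a * r) + of_int y * (real b * r)"
    by (simp add: algebra_simps)
  also have "\<dots> \<in> \<int>"
    by (intro Ints_add Ints_mult[OF Ints_of_int] assms)
  finally show ?thesis .
qed

text \<open>Points of the cone over \<open>P\<close> of height \<open>h > 0\<close> are \<open>h (y, 1)\<close> with \<open>y \<in> P\<close>; by
  Krein-Milman no explicit list of vertices is needed.\<close>

lemma scaleR_mem_cone_over:
  assumes "compact P" "convex P" "y \<in> P" "0 \<le> h"
  shows "(h *\<^sub>R y, h) \<in> cone_over P"
proof -
  let ?E = "{(v, 1::real) | v. v extreme_point_of P}"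
  have "y \<in> convex hull {v. v extreme_point_of P}"
    using Krein_Milman_Minkowski[OF assms(1,2)] assms(3) by blast
  then have "(y, 1::real) \<in> (convex hull {v. v extreme_point_of P}) \<times> (convex hull {1})"
    by simp
  also have "\<dots> = convex hull ({v. v extreme_point_of P} \<times> {1})"
    by (rule convex_hull_Times[symmetric])
  also have "{v. v extreme_point_of P} \<times> {1::real} = ?E" by auto
  also have "convex hull ?E \<subseteq> convex_cone hull ?E"
    by (rule convex_hull_subset_convex_cone_hull)
  finally have "h *\<^sub>R (y, 1::real) \<in> convex_cone hull ?E"
    using \<open>0 \<le> h\<close> by (rule convex_cone_hull_mul)
  then show ?thesis by (simp add: cone_over_def)
qed

section \<open>Homogeneous coordinates and facet functionals\<close>

locale lecture_hall =
  fixes e :: "nat \<Rightarrow> 'n::finite" and s :: "nat \<Rightarrow> nat" and n :: nat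
  assumes n_eq: "n = CARD('n)"
    and bij: "bij_betw e {1..n} UNIV"
    and s_pos_inner: "\<And>i. 1 \<le> i \<Longrightarrow> i \<le> n \<Longrightarrow> s i \<ge> 1"
    and s_0: "s 0 = 1" and s_last: "s (Suc n) = 1"
begin

lemma range_e: "e ` {1..n} = UNIV"
  using bij by (simp add: bij_betw_def)

lemma n_pos: "0 < n"
  by (simp add: n_eq)

lemma s_pos: "k \<le> Suc n \<Longrightarrow> 0 < s k"
  using s_pos_inner[of k] s_0 s_last by (cases "k = 0"; cases "k = Suc n") auto

text \<open>Padding with index \<open>0\<close> and with the height, together with
  \<open>s 0 = s (Suc n) = 1\<close>, gives the outer bounds of the polytope the same form as its
  inner inequalities.\<close>

definition coord :: "(real ^ 'n) \<times> real \<Rightarrow> nat \<Rightarrow> real" where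
  "coord u k = (if k = 0 then 0 else if k \<le> n then fst u $ e k else snd u)"

text \<open>Inverse to \<open>coord\<close> on the indices \<open>1\<close> to \<open>Suc n\<close>;
  the value \<open>y 0\<close> is ignored.\<close>

definition point :: "(nat \<Rightarrow> real) \<Rightarrow> (real ^ 'n) \<times> real" where
  "point y = ((\<chi> i. y (inv_into {1..n} e i)), y (Suc n))"

definition facet :: "nat \<Rightarrow> (real ^ 'n) \<times> real \<Rightarrow> real" where
  "facet k u = (real (s k) * coord u (Suc k) - real (s (Suc k)) * coord u k)
                 / real (gcd (s k) (s (Suc k)))"

definition slope_sum :: "nat \<Rightarrow> real" where
  "slope_sum j = (\<Sum>k=1..j. real (gcd (s (k - 1)) (s k)) / (real (s (k - 1)) * real (s k)))"

lemma coord_0 [simp]: "coord u 0 = 0"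
  by (simp add: coord_def)

lemma coord_point: "k \<in> {1..Suc n} \<Longrightarrow> coord (point y) k = y k"
  using bij by (auto simp: coord_def point_def bij_betw_def le_Suc_eq inv_into_f_f)

lemma coord_add: "coord (u + v) k = coord u k + coord v k"
  by (simp add: coord_def)

lemma coord_diff: "coord (u - v) k = coord u k - coord v k"
  by (simp add: coord_def)

lemma coord_scaleR: "coord (r *\<^sub>R u) k = r * coord u k"
  by (simp add: coord_def)

lemma gcd_pos: "k \<le> n \<Longrightarrow> 0 < gcd (s k) (s (Suc k))"
  using s_pos[of k] by simp

lemma linear_facet: "linear (facet k)"
  by (rule linearI) (auto simp: facet_def coord_add coord_scaleR add_divide_distrib
      diff_divide_distrib algebra_simps)

lemma facet_nonneg_iff:
  "k \<le> n \<Longrightarrow> 0 \<le> facet k u \<longleftrightarrow> coord u k / real (s k) \<le> coord u (Suc k) / real (s (Suc k))"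
  using s_pos[of k] s_pos[of "Suc k"] gcd_pos[of k]
  by (simp add: facet_def field_simps zero_le_divide_iff del: gcd_pos_nat)

lemma mem_integer_points_iff:
  "u \<in> integer_points \<longleftrightarrow> (\<forall>k\<le>Suc n. coord u k \<in> \<int>)"
proof -
  have "(\<forall>i\<in>e ` {1..n}. fst u $ i \<in> \<int>) \<longleftrightarrow> (\<forall>k\<in>{1..n}. fst u $ e k \<in> \<int>)"
    by blast
  then have "(\<forall>i. fst u $ i \<in> \<int>) \<longleftrightarrow> (\<forall>k\<in>{1..n}. fst u $ e k \<in> \<int>)"
    unfolding range_e by simp
  moreover have "{..Suc n} = insert 0 (insert (Suc n) {1..n})" by auto
  then have "(\<forall>k\<in>{..Suc n}. coord u k \<in> \<int>) \<longleftrightarrow> (\<forall>k\<in>{1..n}. fst u $ e k \<in> \<int>) \<and> snd u \<in> \<int>"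
    by (simp add: coord_def conj_commute)
  ultimately show ?thesis
    by (cases u) (simp add: integer_points_def Ball_def)
qed

lemma integer_points_add:
  fixes u v :: "(real ^ 'n) \<times> real"
  shows "u \<in> integer_points \<Longrightarrow> v \<in> integer_points \<Longrightarrow> u + v \<in> integer_points"
  by (simp add: mem_integer_points_iff coord_add)

lemma integer_points_diff:
  fixes u v :: "(real ^ 'n) \<times> real"
  shows "u \<in> integer_points \<Longrightarrow> v \<in> integer_points \<Longrightarrow> u - v \<in> integer_points"
  by (simp add: mem_integer_points_iff coord_diff)

text \<open>Dividing by the gcd leaves integer coefficients. This turns positivity at lattice points
  into \<open>1 \<le> facet k u\<close>.\<close>

lemma facet_Ints:
  assumes "u \<in> integer_points" "k \<le> n"
  shows "facet k u \<in> \<int>"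
proof -
  let ?d = "gcd (s k) (s (Suc k))"
  obtain a b where ab: "s k = ?d * a" "s (Suc k) = ?d * b"
    by (meson dvdE gcd_dvd1 gcd_dvd2)
  have d: "real ?d \<noteq> 0" using gcd_pos[OF assms(2)] by linarith
  have "facet k u = (real (?d * a) * coord u (Suc k) - real (?d * b) * coord u k) / real ?d"
    unfolding facet_def by (subst (1) ab(1), subst (1) ab(2)) (rule refl)
  also have "\<dots> = real a * coord u (Suc k) - real b * coord u k"
    using d by (simp only: of_nat_mult) (simp add: field_simps del: of_nat_eq_0_iff)
  also have "\<dots> \<in> \<int>"
    using assms by (auto simp: mem_integer_points_iff intro!: Ints_diff Ints_mult)
  finally show ?thesis .
qed

lemma facet_ge_1:
  "u \<in> integer_points \<Longrightarrow> k \<le> n \<Longrightarrow> 0 < facet k u \<Longrightarrow> 1 \<le> facet k u"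
  using facet_Ints[of u k] by (auto elim!: Ints_cases)

text \<open>Primitivity of the functional, by Bezout.\<close>

lemma ex_facet_eq_1:
  assumes "k \<le> n"
  shows "\<exists>w\<in>integer_points. facet k w = 1"
proof -
  \<comment> \<open>Coordinate \<open>0\<close> is always zero, so for \<open>k = 0\<close> the
    coefficient \<open>b\<close> must vanish; \<open>s 0 = 1\<close> makes this possible.\<close>
  have "\<exists>a b. (k = 0 \<longrightarrow> b = 0) \<and> int (s k) * a - int (s (Suc k)) * b = int (gcd (s k) (s (Suc k)))"
  proof (cases "k = 0")
    case True
    then show ?thesis by (intro exI[of _ 1] exI[of _ 0]) (simp add: s_0)
  next
    case False
    obtain x y where "x * int (s k) + y * int (s (Suc k)) = gcd (int (s k)) (int (s (Suc k)))"
      using bezout_int by blast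
    with False show ?thesis
      by (intro exI[of _ x] exI[of _ "-y"]) (simp add: algebra_simps)
  qed
  then obtain a b where ab: "k = 0 \<longrightarrow> b = 0"
    "int (s k) * a - int (s (Suc k)) * b = int (gcd (s k) (s (Suc k)))" by blast
  let ?w = "point (\<lambda>i. if i = k then of_int b else if i = Suc k then of_int a else 0)"
  have "coord ?w j = (if j = k then of_int b else if j = Suc k then of_int a else 0)"
    if "j \<le> Suc n" for j
    using ab(1) that by (cases "j = 0") (auto simp: coord_point)
  moreover have "real (s k) * of_int a - real (s (Suc k)) * of_int b = real (gcd (s k) (s (Suc k)))"
    using arg_cong[OF ab(2), of real_of_int] by simp
  ultimately show ?thesis
    using assms gcd_pos[OF assms]
    by (intro bexI[of _ ?w]) (auto simp: facet_def mem_integer_points_iff simp del: gcd_pos_nat)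
qed

text \<open>Provides a lattice direction in which every other facet functional grows while
  \<open>facet k\<close> stays fixed.\<close>

lemma ex_facet_relative_interior_point:
  assumes "k \<le> n"
  shows "\<exists>z\<in>integer_points. facet k z = 0 \<and> (\<forall>j\<le>n. j \<noteq> k \<longrightarrow> 0 < facet j z)"
proof -
  \<comment> \<open>The ratios of the coordinates to \<open>s\<close> will be \<open>t i\<close>,
    which grow by one at each step except that \<open>t k = t (Suc k)\<close>.\<close>
  define t where "t i = (if i \<le> k then i else i - 1)" for i :: nat
  let ?z = "point (\<lambda>i. real (s i) * real (t i))"
  have c: "coord ?z j = real (s j) * real (t j)" if "j \<le> Suc n" for j
    using that by (cases "j = 0") (auto simp: coord_point t_def)
  have f: "facet j ?z = real (s j) * real (s (Suc j)) * (real (t (Suc j)) - real (t j))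
             / real (gcd (s j) (s (Suc j)))" if "j \<le> n" for j
    using that by (simp add: facet_def c algebra_simps)
  have "0 < facet j ?z" if "j \<le> n" "j \<noteq> k" for j
  proof -
    have "t j < t (Suc j)" using that by (auto simp: t_def)
    then show ?thesis
      unfolding f[OF that(1)] using s_pos[of j] s_pos[of "Suc j"] gcd_pos[of j] that
      by (intro divide_pos_pos mult_pos_pos) auto
  qed
  moreover have "facet k ?z = 0" using f[OF assms] by (simp add: t_def)
  moreover have "?z \<in> integer_points" by (simp add: mem_integer_points_iff c)
  ultimately show ?thesis by blast
qed

section \<open>The polytope, its cone and the interior of the cone\<close>

lemma mem_polytope_iff:
  "x \<in> lecture_hall_polytope e s \<longleftrightarrow> (\<forall>k\<le>n. 0 \<le> facet k (x, 1))"
proof -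
  have c: "coord (x, 1) k = x $ e k" if "k \<in> {1..n}" for k
    using that by (simp add: coord_def)
  have last: "coord (x, 1) (Suc n) = 1" by (simp add: coord_def)
  \<comment> \<open>Facets \<open>0\<close> and \<open>n\<close> are the outer bounds of the
    polytope, the others its inner inequalities.\<close>
  have split: "{..n} = insert 0 (insert n {1..<n})" using n_pos by auto
  have "(\<forall>k\<le>n. 0 \<le> facet k (x, 1)) \<longleftrightarrow>
        (\<forall>k\<in>{..n}. coord (x, 1) k / real (s k) \<le> coord (x, 1) (Suc k) / real (s (Suc k)))"
    by (auto simp: facet_nonneg_iff)
  also have "\<dots> \<longleftrightarrow> x \<in> lecture_hall_polytope e s"
    unfolding split using n_pos
    by (auto simp: lecture_hall_polytope_def n_eq[symmetric] c last s_last)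
  finally show ?thesis by simp
qed

text \<open>Comparison with the indices \<open>0\<close> and \<open>Suc n\<close> will trap each
  coordinate between \<open>0\<close> and \<open>s j\<close> times the height. Hence the polytope is
  bounded, and the only point of height zero is the origin.\<close>

lemma coord_ratio_mono:
  assumes "\<forall>k\<le>n. 0 \<le> facet k u" "i \<le> j" "j \<le> Suc n"
  shows "coord u i / real (s i) \<le> coord u j / real (s j)"
  using assms(2,3)
proof (induction j rule: dec_induct)
  case (step j)
  have "coord u j / real (s j) \<le> coord u (Suc j) / real (s (Suc j))"
    using assms(1) step.prems by (simp add: facet_nonneg_iff[symmetric])
  with step show ?case by simp
qed simp

lemma coord_nonneg:
  assumes "\<forall>k\<le>n. 0 \<le> facet k u" "j \<le> Suc n"
  shows "0 \<le> coord u j"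
  using coord_ratio_mono[OF assms(1) _ assms(2), of 0] s_pos[OF assms(2)]
  by (simp add: zero_le_divide_iff)

lemma coord_le:
  assumes "\<forall>k\<le>n. 0 \<le> facet k u" "j \<le> Suc n"
  shows "coord u j \<le> real (s j) * snd u"
  using coord_ratio_mono[OF assms] assms(2) s_pos[OF assms(2)]
  by (simp add: s_last coord_def[of u "Suc n"] field_simps)

lemma compact_polytope: "compact (lecture_hall_polytope e s)"
proof -
  have "closed (\<Inter>k\<in>{..n}. {x. 0 \<le> facet k (x, 1)})"
    by (intro closed_INT ballI closed_Collect_le continuous_intros
        linear_continuous_on_compose[OF _ linear_facet])
  also have "(\<Inter>k\<in>{..n}. {x. 0 \<le> facet k (x, 1)}) = lecture_hall_polytope e s"
    by (auto simp: mem_polytope_iff)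
  finally have "closed (lecture_hall_polytope e s)" .
  moreover have "bounded (lecture_hall_polytope e s)"
  proof (rule bounded_subset[OF bounded_cbox])
    show "lecture_hall_polytope e s \<subseteq> cbox 0 (\<chi> i. real (s (inv_into {1..n} e i)))"
    proof
      fix x assume "x \<in> lecture_hall_polytope e s"
      then have f: "\<forall>k\<le>n. 0 \<le> facet k (x, 1)" by (simp add: mem_polytope_iff)
      have "0 \<le> x $ i \<and> x $ i \<le> real (s (inv_into {1..n} e i))" for i
      proof -
        obtain k where k: "k \<in> {1..n}" "i = e k"
          using range_e by blast
        have "inv_into {1..n} e i = k" using bij k by (simp add: bij_betw_def inv_into_f_f)
        then show ?thesis
          using coord_nonneg[OF f, of k] coord_le[OF f, of k] k by (simp add: coord_def)
      qed
      then show "x \<in> cbox 0 (\<chi> i. real (s (inv_into {1..n} e i)))"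
        by (simp add: mem_box_cart)
    qed
  qed
  ultimately show ?thesis by (simp add: compact_eq_bounded_closed)
qed

lemma convex_cone_facets: "convex_cone {u. \<forall>k\<le>n. 0 \<le> facet k u}"
  unfolding convex_cone_iff
  by (intro conjI ballI allI impI)
    (simp_all add: linear_0[OF linear_facet] linear_add[OF linear_facet] linear_cmul[OF linear_facet])

lemma convex_polytope: "convex (lecture_hall_polytope e s)"
proof (rule convexI)
  fix x y and a b :: real
  assume *: "x \<in> lecture_hall_polytope e s" "y \<in> lecture_hall_polytope e s"
    "0 \<le> a" "0 \<le> b" "a + b = 1"
  have "(a *\<^sub>R x + b *\<^sub>R y, 1) = a *\<^sub>R (x, 1::real) + b *\<^sub>R (y, 1)" using * by simp
  then show "a *\<^sub>R x + b *\<^sub>R y \<in> lecture_hall_polytope e s"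
    using * by (simp add: mem_polytope_iff linear_add[OF linear_facet] linear_cmul[OF linear_facet]
        del: add_Pair scaleR_Pair)
qed

text \<open>The vertices satisfy the facet inequalities, which define a convex cone. Conversely, a
  point of positive height rescales into the polytope, and a point of height zero is the
  origin.\<close>

lemma cone_over_eq: "cone_over (lecture_hall_polytope e s) = {u. \<forall>k\<le>n. 0 \<le> facet k u}"
proof
  have "{(v, 1) | v. v extreme_point_of lecture_hall_polytope e s} \<subseteq> {u. \<forall>k\<le>n. 0 \<le> facet k u}"
    by (auto simp: extreme_point_of_def mem_polytope_iff)
  then show "cone_over (lecture_hall_polytope e s) \<subseteq> {u. \<forall>k\<le>n. 0 \<le> facet k u}"
    unfolding cone_over_def by (rule hull_minimal) (rule convex_cone_facets)
next
  show "{u. \<forall>k\<le>n. 0 \<le> facet k u} \<subseteq> cone_over (lecture_hall_polytope e s)"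
  proof
    fix u assume "u \<in> {u. \<forall>k\<le>n. 0 \<le> facet k u}"
    then have f: "\<forall>k\<le>n. 0 \<le> facet k u" by simp
    obtain x h where u: "u = (x, h)" by (cases u)
    have h: "0 \<le> h" using coord_nonneg[OF f, of "Suc n"] by (simp add: coord_def u)
    show "u \<in> cone_over (lecture_hall_polytope e s)"
    proof (cases "h = 0")
      case True
      have "x $ i = 0" for i
      proof -
        obtain k where k: "k \<in> {1..n}" "i = e k"
          using range_e by blast
        then show ?thesis
          using coord_nonneg[OF f, of k] coord_le[OF f, of k] True by (simp add: coord_def u)
      qed
      then have "u = 0" using True by (simp add: u vec_eq_iff zero_prod_def)
      then show ?thesis by (simp add: cone_over_def convex_cone_hull_contains_0)
    next
      case False
      have "(inverse h *\<^sub>R x, 1) = inverse h *\<^sub>R u" using False by (simp add: u)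
      then have "inverse h *\<^sub>R x \<in> lecture_hall_polytope e s"
        using f h by (simp add: mem_polytope_iff linear_cmul[OF linear_facet])
      from scaleR_mem_cone_over[OF compact_polytope convex_polytope this h]
      show ?thesis using False by (simp add: u)
    qed
  qed
qed

text \<open>The cone has nonempty interior, so its relative interior is its interior.\<close>

lemma rel_interior_cone_over:
  "rel_interior (cone_over (lecture_hall_polytope e s)) = {u. \<forall>k\<le>n. 0 < facet k u}"
proof -
  have int: "interior {u. \<forall>k\<in>{..n}. 0 \<le> facet k u} = {u. \<forall>k\<in>{..n}. 0 < facet k u}"
  proof (rule interior_linear_nonneg)
    fix k assume "k \<in> {..n}"
    then obtain w where "facet k w = 1" using ex_facet_eq_1[of k] by auto
    then show "\<exists>u. facet k u \<noteq> 0" by (intro exI[of _ w]) simp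
  qed (auto intro: linear_facet)
  \<comment> \<open>The ratios of coordinates to \<open>s\<close> are \<open>0, 1, 2, ...\<close>,
    so every facet inequality is strict.\<close>
  let ?v = "point (\<lambda>i. real (s i) * real i)"
  have "0 < facet k ?v" if "k \<le> n" for k
  proof -
    have "coord ?v j = real (s j) * real j" if "j \<le> Suc n" for j
      using that by (cases "j = 0") (auto simp: coord_point)
    then have "facet k ?v = real (s k) * real (s (Suc k)) / real (gcd (s k) (s (Suc k)))"
      using that by (simp add: facet_def algebra_simps)
    then show ?thesis using s_pos[of k] s_pos[of "Suc k"] gcd_pos[of k] that by simp
  qed
  then have "?v \<in> interior (cone_over (lecture_hall_polytope e s))"
    using int by (simp add: cone_over_eq Ball_def)
  then have "interior (cone_over (lecture_hall_polytope e s)) \<noteq> {}" by blast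
  then show ?thesis
    using int by (simp add: rel_interior_nonempty_interior cone_over_eq Ball_def)
qed

section \<open>The Gorenstein property as a linear system\<close>

text \<open>For each \<open>k\<close> some interior lattice point has \<open>facet k\<close> equal
  to \<open>1\<close>; it is \<open>g\<close> plus a point of the cone, which bounds
  \<open>facet k g\<close> above by \<open>1\<close>.\<close>

lemma gorenstein_iff_facets_eq_1:
  "gorenstein_polytope (lecture_hall_polytope e s) \<longleftrightarrow>
     (\<exists>g\<in>integer_points. \<forall>k\<le>n. facet k g = 1)"
proof
  assume "gorenstein_polytope (lecture_hall_polytope e s)"
  then obtain g where g: "g \<in> integer_points"
    and eq: "(\<lambda>u. g + u) ` ({u. \<forall>k\<le>n. 0 \<le> facet k u} \<inter> integer_points)
               = {u. \<forall>k\<le>n. 0 < facet k u} \<inter> integer_points"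
    by (auto simp: gorenstein_polytope_def cone_over_eq rel_interior_cone_over[unfolded cone_over_eq])
  \<comment> \<open>The apex is a lattice point of the cone, so its translate \<open>g\<close> is
    itself interior.\<close>
  have "0 \<in> {u. \<forall>k\<le>n. 0 \<le> facet k u} \<inter> integer_points"
    by (simp add: linear_0[OF linear_facet] mem_integer_points_iff coord_def)
  then have "g + 0 \<in> {u. \<forall>k\<le>n. 0 < facet k u} \<inter> integer_points"
    unfolding eq[symmetric] by (rule imageI)
  then have ge: "1 \<le> facet k g" if "k \<le> n" for k
    using facet_ge_1[OF g that] that by simp
  have "facet k g \<le> 1" if k: "k \<le> n" for k
  proof -
    obtain w where w: "w \<in> integer_points" "facet k w = 1" using ex_facet_eq_1[OF k] by blast
    obtain z where z: "z \<in> integer_points" "facet k z = 0" "\<forall>j\<le>n. j \<noteq> k \<longrightarrow> 0 < facet j z"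
      using ex_facet_relative_interior_point[OF k] by blast
    \<comment> \<open>Moving \<open>w\<close> far along the facet makes it interior without changing \<open>facet k w = 1\<close>.\<close>
    define N where "N = nat (\<Sum>j\<le>n. \<lceil>\<bar>facet j w\<bar>\<rceil>) + 1"
    let ?v = "w + real N *\<^sub>R z"
    have fv: "facet j ?v = facet j w + real N * facet j z" for j
      by (simp add: linear_add[OF linear_facet] linear_cmul[OF linear_facet])
    have "0 < facet j ?v" if j: "j \<le> n" for j
    proof (cases "j = k")
      case True
      then show ?thesis using w z by (simp add: fv)
    next
      case False
      have "1 \<le> facet j z" using facet_ge_1[OF z(1) j] z(3) False j by blast
      moreover have "\<bar>facet j w\<bar> < real N"
      proof -
        have "\<lceil>\<bar>facet j w\<bar>\<rceil> \<le> (\<Sum>j\<le>n. \<lceil>\<bar>facet j w\<bar>\<rceil>)"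
          by (rule member_le_sum) (use j in auto)
        then have "\<lceil>\<bar>facet j w\<bar>\<rceil> < int N" unfolding N_def by linarith
        then show ?thesis by linarith
      qed
      ultimately show ?thesis
        unfolding fv using mult_left_mono[of 1 "facet j z" "real N"] by simp
    qed
    moreover have "?v \<in> integer_points"
      using w(1) z(1) by (auto simp: mem_integer_points_iff coord_add coord_scaleR intro!: Ints_add Ints_mult)
    ultimately have "?v \<in> (\<lambda>u. g + u) ` ({u. \<forall>k\<le>n. 0 \<le> facet k u} \<inter> integer_points)"
      unfolding eq by simp
    then obtain u where "?v = g + u" "0 \<le> facet k u" using k by blast
    then have "facet k g \<le> facet k ?v" by (simp add: linear_add[OF linear_facet])
    then show ?thesis using w(2) z(2) by (simp add: fv)
  qed
  with ge g show "\<exists>g\<in>integer_points. \<forall>k\<le>n. facet k g = 1" by (metis antisym)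
next
  assume "\<exists>g\<in>integer_points. \<forall>k\<le>n. facet k g = 1"
  then obtain g where g: "g \<in> integer_points" and 1: "\<And>k. k \<le> n \<Longrightarrow> facet k g = 1" by blast
  have "(\<lambda>u. g + u) ` ({u. \<forall>k\<le>n. 0 \<le> facet k u} \<inter> integer_points)
          = {u. \<forall>k\<le>n. 0 < facet k u} \<inter> integer_points"
  proof (intro equalityI subsetI)
    fix v assume "v \<in> (\<lambda>u. g + u) ` ({u. \<forall>k\<le>n. 0 \<le> facet k u} \<inter> integer_points)"
    then show "v \<in> {u. \<forall>k\<le>n. 0 < facet k u} \<inter> integer_points"
      using g by (auto simp: linear_add[OF linear_facet] 1 intro: integer_points_add add_pos_nonneg)
  next
    fix v assume v: "v \<in> {u. \<forall>k\<le>n. 0 < facet k u} \<inter> integer_points"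
    \<comment> \<open>Each functional is at least \<open>1\<close> at an interior lattice point, so
      subtracting \<open>g\<close> leaves it nonnegative.\<close>
    then have "v - g \<in> {u. \<forall>k\<le>n. 0 \<le> facet k u} \<inter> integer_points"
      using g by (auto simp: linear_diff[OF linear_facet] 1 facet_ge_1 intro: integer_points_diff)
    then show "v \<in> (\<lambda>u. g + u) ` ({u. \<forall>k\<le>n. 0 \<le> facet k u} \<inter> integer_points)"
      by (rule rev_image_eqI) simp
  qed
  with g show "gorenstein_polytope (lecture_hall_polytope e s)"
    unfolding gorenstein_polytope_def rel_interior_cone_over unfolding cone_over_eq by blast
qed

section \<open>Solving the linear system\<close>

lemma slope_sum_0 [simp]: "slope_sum 0 = 0"
  by (simp add: slope_sum_def)

lemma slope_sum_Suc:
  "slope_sum (Suc k) = slope_sum k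
     + real (gcd (s k) (s (Suc k))) / (real (s k) * real (s (Suc k)))"
  by (simp add: slope_sum_def)

text \<open>After division by \<open>s k * s (Suc k)\<close> over the gcd, the equation prescribes
  the increment of the ratio \<open>coord u k / s k\<close>.\<close>

lemma facet_eq_1_iff:
  assumes "k \<le> n"
  shows "facet k u = 1 \<longleftrightarrow>
    coord u (Suc k) / real (s (Suc k)) - coord u k / real (s k) = slope_sum (Suc k) - slope_sum k"
  using s_pos[of k] s_pos[of "Suc k"] gcd_pos[of k] assms
  by (auto simp: facet_def slope_sum_Suc field_simps simp del: gcd_pos_nat)

text \<open>The ratios and the partial sums both start at \<open>0\<close> and have equal
  increments.\<close>

lemma facets_eq_1_iff:
  "(\<forall>k\<le>n. facet k u = 1) \<longleftrightarrow> (\<forall>k\<le>Suc n. coord u k = real (s k) * slope_sum k)"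
proof
  assume 1: "\<forall>k\<le>n. facet k u = 1"
  have "coord u k / real (s k) = slope_sum k" if "k \<le> Suc n" for k
    using that
  proof (induction k)
    case (Suc k)
    then show ?case using 1 facet_eq_1_iff[of k u] by simp
  qed simp
  then show "\<forall>k\<le>Suc n. coord u k = real (s k) * slope_sum k"
    using s_pos by (auto simp: field_simps)
next
  assume c: "\<forall>k\<le>Suc n. coord u k = real (s k) * slope_sum k"
  show "\<forall>k\<le>n. facet k u = 1"
  proof (intro allI impI)
    fix k assume "k \<le> n"
    then show "facet k u = 1" using c s_pos[of k] s_pos[of "Suc k"] by (simp add: facet_eq_1_iff)
  qed
qed

lemma gorenstein_iff_Ints:
  "gorenstein_polytope (lecture_hall_polytope e s) \<longleftrightarrow>
     (\<forall>k\<le>Suc n. real (s k) * slope_sum k \<in> \<int>)"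
proof -
  define g where "g = point (\<lambda>k. real (s k) * slope_sum k)"
  have g: "coord g k = real (s k) * slope_sum k" if "k \<le> Suc n" for k
    using that by (cases "k = 0") (auto simp: g_def coord_point)
  show ?thesis
    unfolding gorenstein_iff_facets_eq_1 facets_eq_1_iff
  proof
    assume "\<forall>k\<le>Suc n. real (s k) * slope_sum k \<in> \<int>"
    then have "g \<in> integer_points" by (simp add: mem_integer_points_iff g)
    with g show "\<exists>u\<in>integer_points. \<forall>k\<le>Suc n. coord u k = real (s k) * slope_sum k" by blast
  qed (auto simp: mem_integer_points_iff)
qed

section \<open>The two families of numbers in the theorem\<close>

text \<open>The leading fraction is \<open>s j\<close> times the last term of
  \<open>slope_sum j\<close>.\<close>

lemma forward_expression:
  assumes "2 \<le> j" "j \<le> n"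
  shows "real (gcd (s (j - 1)) (s j)) / real (s (j - 1))
        + real (s j) * (\<Sum>k=1..j - 1. real (gcd (s (k - 1)) (s k)) / (real (s (k - 1)) * real (s k)))
       = real (s j) * slope_sum j"
  unfolding slope_sum_def[of "j - 1", symmetric]
  using slope_sum_Suc[of "j - 1"] assms s_pos[of j] by (simp add: algebra_simps)

text \<open>Read from the top, the \<open>k\<close>-th term is the increment of
  \<open>slope_sum\<close> from \<open>n - k + 1\<close> to \<open>n - k + 2\<close>.\<close>

lemma backward_sum:
  "p \<le> n \<Longrightarrow> (\<Sum>k=1..p. real (gcd (s (n - k + 2)) (s (n - k + 1)))
        / (real (s (n - k + 2)) * real (s (n - k + 1)))) = slope_sum (Suc n) - slope_sum (Suc n - p)"
proof (induction p)
  case (Suc p)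
  define q where "q = n - Suc p"
  have q: "Suc n - p = Suc (Suc q)" "Suc n - Suc p = Suc q" "n - Suc p = q"
    using Suc.prems by (auto simp: q_def)
  have "(\<Sum>k=1..Suc p. real (gcd (s (n - k + 2)) (s (n - k + 1)))
        / (real (s (n - k + 2)) * real (s (n - k + 1)))) =
      slope_sum (Suc n) - slope_sum (Suc n - p)
        + real (gcd (s (Suc (Suc q))) (s (Suc q))) / (real (s (Suc (Suc q))) * real (s (Suc q)))"
    using Suc q(3) by simp
  then show ?case
    unfolding q using slope_sum_Suc[of "Suc q"] by (simp add: gcd.commute mult.commute)
qed simp

text \<open>With \<open>i = n - j + 1\<close>, the leading fraction is \<open>s i\<close> times the
  increment from \<open>i\<close> to \<open>Suc i\<close>, which extends the backward sum down to
  \<open>slope_sum i\<close>.\<close>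

lemma backward_expression:
  assumes "2 \<le> j" "j \<le> n"
  shows "real (gcd (s (n - j + 2)) (s (n - j + 1))) / real (s (n - j + 2))
        + real (s (n - j + 1)) *
          (\<Sum>k=1..j - 1. real (gcd (s (n - k + 2)) (s (n - k + 1)))
                          / (real (s (n - k + 2)) * real (s (n - k + 1))))
       = real (s (n - j + 1)) * slope_sum (Suc n) - real (s (n - j + 1)) * slope_sum (n - j + 1)"
proof -
  define i where "i = n - j + 1"
  have i: "n - j + 2 = Suc i" "n - j + 1 = i" "Suc n - (j - 1) = Suc i" "j - 1 \<le> n" "i \<le> n"
    using assms by (auto simp: i_def)
  show ?thesis
    unfolding backward_sum[OF i(4)] i(1-3)
    using slope_sum_Suc[of i] s_pos[of i] s_pos[of "Suc i"] i(5)
    by (simp add: field_simps gcd.commute)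
qed

end

theorem theorem2:
  fixes n :: nat and s :: "nat \<Rightarrow> nat" and e :: "nat \<Rightarrow> 'n::finite"
  assumes "n = CARD('n)"
    and "bij_betw e {1..n} UNIV"
    and "\<And>i. 1 \<le> i \<Longrightarrow> i \<le> n \<Longrightarrow> s i \<ge> 1"
    and "\<exists>i. 1 < i \<and> i \<le> n \<and> gcd (s (i - 1)) (s i) = 1"
    and "s 0 = 1" and "s (n + 1) = 1"
  shows "gorenstein_polytope (lecture_hall_polytope e s) \<longleftrightarrow>
    (\<forall>j. 2 \<le> j \<and> j \<le> n \<longrightarrow>
      real (gcd (s (j - 1)) (s j)) / real (s (j - 1))
        + real (s j) * (\<Sum>k=1..j - 1. real (gcd (s (k - 1)) (s k)) / (real (s (k - 1)) * real (s k)))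
        \<in> \<int> \<and>
      real (gcd (s (n - j + 2)) (s (n - j + 1))) / real (s (n - j + 2))
        + real (s (n - j + 1)) *
          (\<Sum>k=1..j - 1. real (gcd (s (n - k + 2)) (s (n - k + 1)))
                          / (real (s (n - k + 2)) * real (s (n - k + 1))))
        \<in> \<int>)"
proof -
  interpret lecture_hall e s n
    using assms by unfold_locales auto
  define g where "g k = real (s k) * slope_sum k" for k
  define h where "h = slope_sum (Suc n)"
  have s1: "1 \<le> n" using n_pos by simp
  have bounds [simp]: "g 0 = 0" "g (Suc n) = h" by (simp_all add: g_def h_def s_last)
  \<comment> \<open>The range of \<open>j\<close> leaves out \<open>g 1\<close> in the first family
    and index \<open>n\<close> in the second; this value and \<open>top\<close> supply both.\<close>
  have g_1: "g 1 = 1"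
    using s_pos[of 1] s1 by (simp add: g_def slope_sum_def s_0)
  have top: "real (s n) * h - g n = 1"
    using s_pos[of n] by (simp add: g_def h_def slope_sum_Suc s_last algebra_simps)
  have "(\<forall>k\<le>Suc n. g k \<in> \<int>) \<longleftrightarrow>
      (\<forall>j. 2 \<le> j \<and> j \<le> n \<longrightarrow>
         g j \<in> \<int> \<and> real (s (n - j + 1)) * h - g (n - j + 1) \<in> \<int>)" (is "?L \<longleftrightarrow> ?R")
  proof
    assume ?L
    then have "g k \<in> \<int>" if "k \<le> Suc n" for k using that by blast
    moreover from this[of "Suc n"] have "h \<in> \<int>" by simp
    ultimately show ?R by (auto intro!: Ints_diff Ints_mult)
  next
    assume R: ?R
    have g_int: "g j \<in> \<int>" if "j \<le> n" for j
    proof -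
      consider "j = 0" | "j = 1" | "2 \<le> j" by linarith
      then show ?thesis using R that g_1 by cases auto
    qed
    have sh: "real (s i) * h \<in> \<int>" if "1 \<le> i" "i \<le> n" for i
    proof -
      have "real (s i) * h - g i \<in> \<int>"
      proof (cases "i = n")
        case False
        \<comment> \<open>The second number concerns index \<open>i\<close> when
          \<open>j = n + 1 - i\<close>.\<close>
        have "2 \<le> n + 1 - i \<and> n + 1 - i \<le> n" "n - (n + 1 - i) + 1 = i"
          using that False by auto
        then show ?thesis using R by metis
      qed (simp add: top)
      then have "real (s i) * h - g i + g i \<in> \<int>" using g_int that by (intro Ints_add) auto
      then show ?thesis by simp
    qed
    \<comment> \<open>Since \<open>1 < i\<close>, both \<open>i - 1\<close> and \<open>i\<close> lie
      in the range of \<open>sh\<close>.\<close>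
    from assms(4) obtain i where i: "1 < i" "i \<le> n" "gcd (s (i - 1)) (s i) = 1"
      by (elim exE conjE)
    have "h \<in> \<int>"
    proof (rule Ints_of_coprime_multiples)
      show "coprime (s (i - 1)) (s i)" using i(3) by (simp only: coprime_iff_gcd_eq_1)
    qed (use i(1,2) in \<open>simp_all add: sh\<close>)
    with g_int show ?L by (auto simp: le_Suc_eq)
  qed
  then show ?thesis
    by (simp only: gorenstein_iff_Ints forward_expression backward_expression g_def h_def cong: imp_cong)
qed

end
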